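(* Let $P$ be a simple polytope of dimension $n\ge 2$, let $p$ be a vertex of $P$, and let $G\subset \mathrm{cut}_pP$ be the new facet of the truncated polytope $\mathrm{cut}_pP$ (so $G$ is a simplex $\Delta^{n-1}$). Let $0\le k\le n-2$, and let $S_1=\Delta^k$ and $S_2=\Delta^{n-k-2}$ be two complementary (i.e. non-intersecting) faces of the simplex $G$. Then the polytopes $\mathrm{cut}_{S_1}(\mathrm{cut}_pP)$ and $\mathrm{cut}_{S_2}(\mathrm{cut}_pP)$ are combinatorially equivalent.
   Context: An $n$-dimensional convex polytope is simple if each of its vertices lies in exactly $n$ facets. For a proper face $F$ of a simple polytope $P$, the truncation $\mathrm{cut}_FP$ is the polytope $P\cap H^{+}$, where $H^+$ is a closed half-space whose bounding hyperplane $H$ strictly separates the vertices of $F$ from the remaining vertices of $P$, with the vertices of $F$ lying outside $H^+$; its new facet is $P\cap H$. The combinatorial type of $\mathrm{cut}_FP$ does not depend on the choice of $H$. Two polytopes are combinatorially equivalent if their face lattices are isomorphic. *)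

theory Defs
  imports "HOL-Analysis.Analysis"
begin

definition simple_polytope :: "'a::euclidean_space set \<Rightarrow> bool" where
  "simple_polytope P \<longleftrightarrow>
     polytope P \<and>
     (\<forall>v. v extreme_point_of P \<longrightarrow> int (card {F. F facet_of P \<and> v \<in> F}) = aff_dim P)"

text \<open>Truncation depends on the choice of a hyperplane, so it is a relation:
  some admissible hyperplane cuts \<open>F\<close> off \<open>P\<close>, leaving \<open>Q\<close> with new facet \<open>G\<close>.\<close>

definition is_truncation ::
    "'a::euclidean_space set \<Rightarrow> 'a set \<Rightarrow> 'a set \<Rightarrow> 'a set \<Rightarrow> bool" where
  "is_truncation P F Q G \<longleftrightarrow>
     F face_of P \<and> F \<noteq> {} \<and> F \<noteq> P \<and>
     (\<exists>a b. a \<noteq> 0 \<and>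
        (\<forall>v. v extreme_point_of F \<longrightarrow> a \<bullet> v > b) \<and>
        (\<forall>v. v extreme_point_of P \<and> \<not> v extreme_point_of F \<longrightarrow> a \<bullet> v < b) \<and>
        Q = P \<inter> {x. a \<bullet> x \<le> b} \<and>
        G = P \<inter> {x. a \<bullet> x = b})"

text \<open>The face lattice includes the improper faces \<open>{}\<close> and \<open>P\<close>, as does \<open>face_of\<close>.\<close>

definition combinatorially_equivalent ::
    "'a::euclidean_space set \<Rightarrow> 'b::euclidean_space set \<Rightarrow> bool" where
  "combinatorially_equivalent P Q \<longleftrightarrow>
     (\<exists>f. bij_betw f {F. F face_of P} {F. F face_of Q} \<and>
          (\<forall>F F'. F face_of P \<and> F' face_of P \<longrightarrow> (F \<subseteq> F' \<longleftrightarrow> f F \<subseteq> f F')))"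

lemma is_truncation_exists:
  assumes P: "polytope P" and F: "F face_of P" "F \<noteq> {}" "F \<noteq> P"
  shows "\<exists>Q G. is_truncation P F Q G"
proof -
  have "F exposed_face_of P"
    using F P by (simp add: exposed_face_of_polyhedron polytope_imp_polyhedron)
  then obtain a b where ab: "P \<subseteq> {x. a \<bullet> x \<le> b}" "F = P \<inter> {x. a \<bullet> x = b}"
    unfolding exposed_face_of_def by blast
  have a0: "a \<noteq> 0" using ab F by auto
  let ?V = "{v. v extreme_point_of P \<and> \<not> v extreme_point_of F}"
  have fin: "finite ?V"
    using finite_polyhedron_extreme_points[OF polytope_imp_polyhedron[OF P]]
    by (rule rev_finite_subset) auto
  have lt: "a \<bullet> v < b" if "v \<in> ?V" for v
  proof -
    have "v \<in> P" using that by (simp add: extreme_point_of_def)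
    moreover have "v \<notin> F" using that extreme_point_of_face[OF F(1)] by blast
    ultimately show ?thesis using ab by force
  qed
  define c where "c = Max (insert (b - 1) ((\<bullet>) a ` ?V))"
  have c: "c < b" unfolding c_def using fin lt by (subst Max_less_iff) auto
  have cV: "a \<bullet> v \<le> c" if "v \<in> ?V" for v unfolding c_def using fin that by (intro Max_ge) auto
  have 1: "\<forall>v. v extreme_point_of F \<longrightarrow> a \<bullet> v > (b + c) / 2"
    using ab c by (auto simp: extreme_point_of_def)
  have 2: "\<forall>v. v extreme_point_of P \<and> \<not> v extreme_point_of F \<longrightarrow> a \<bullet> v < (b + c) / 2"
    using cV c by fastforce
  show ?thesis unfolding is_truncation_def using F a0 1 2 by blast
qed

end

theory Submission
  imports Defs
begin

text \<open>If \<open>Q\<close> is the truncation of \<open>P\<close> at \<open>F\<close> with new facet \<open>G\<close>, its nonempty faces are the sets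
  \<open>E \<inter> Q\<close> and \<open>E \<inter> G\<close> for faces \<open>E\<close> of \<open>P\<close> not inside \<open>F\<close>, the second kind only when \<open>E\<close> meets \<open>F\<close>; inclusion
  is componentwise in \<open>E\<close> and in the kind. Applying this twice, a nonempty face of the truncation of
  \<open>Q\<close> at \<open>S\<^sub>1\<close> is a triple \<open>(E, s, t)\<close> with two flags. When \<open>S\<^sub>1\<close> and \<open>S\<^sub>2\<close> are complementary, a face
  of \<open>G\<close> lies in one of them iff it misses the other, so the conditions on \<open>s\<close> and \<open>t\<close> become
  \<open>E \<inter> G \<inter> S\<^sub>2 \<noteq> {}\<close> and \<open>E \<inter> G \<inter> S\<^sub>1 \<noteq> {}\<close>, and exchanging the flags is the desired equivalence.

  That \<open>G\<close> is a simplex: each of its vertices lies on a single edge of \<open>P\<close> at \<open>p\<close>, and such an edge is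
  determined by the unique facet at \<open>p\<close> that does not contain it. So \<open>G\<close> has dimension \<open>n - 1\<close> and at
  most \<open>n\<close> vertices.\<close>

section \<open>Convex sets crossed by a hyperplane\<close>

text \<open>The relative interior of a convex set is dense in it.\<close>

lemma convex_rel_interior_Int_open_nonempty:
  fixes E :: "'a::euclidean_space set"
  assumes "convex E" "open U" "E \<inter> U \<noteq> {}"
  shows "rel_interior E \<inter> U \<noteq> {}"
proof -
  have "U \<inter> closure (rel_interior E) \<noteq> {}"
    using assms closure_subset convex_closure_rel_interior by blast
  then show ?thesis
    using open_Int_closure_eq_empty[OF assms(2)] by blast
qed

text \<open>By density the relative interior has points on both sides, and being connected it cannot
  avoid the hyperplane.\<close>

lemma convex_rel_interior_Int_hyperplane_nonempty:
  fixes E :: "'a::euclidean_space set"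
  assumes "convex E" "E \<inter> {x. a \<bullet> x < b} \<noteq> {}" "E \<inter> {x. a \<bullet> x > b} \<noteq> {}"
  shows "rel_interior E \<inter> {x. a \<bullet> x = b} \<noteq> {}"
proof -
  have "rel_interior E \<inter> {x. a \<bullet> x < b} \<noteq> {}"
    by (rule convex_rel_interior_Int_open_nonempty) (use assms open_halfspace_lt in auto)
  then obtain x where x: "x \<in> rel_interior E" "a \<bullet> x < b" by blast
  have "rel_interior E \<inter> {x. a \<bullet> x > b} \<noteq> {}"
    by (rule convex_rel_interior_Int_open_nonempty) (use assms open_halfspace_gt in auto)
  then obtain y where y: "y \<in> rel_interior E" "a \<bullet> y > b" by blast
  have "connected (rel_interior E)"
    using assms convex_rel_interior convex_connected by blast
  from connected_ivt_hyperplane[OF this x(1) y(1), of a b] x y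
  show ?thesis by auto
qed

text \<open>The hyperplane meets the relative interior of \<open>E\<close>, so the section contains
  a nonempty relatively open piece of the flat \<open>affine hull E \<inter> ?H\<close> and spans
  it. This flat has dimension one less, because \<open>E\<close> also has points off the
  hyperplane.\<close>

lemma aff_dim_Int_separating_hyperplane:
  fixes E :: "'a::euclidean_space set"
  assumes "convex E" "E \<inter> {x. a \<bullet> x < b} \<noteq> {}" "E \<inter> {x. a \<bullet> x > b} \<noteq> {}"
  shows "aff_dim (E \<inter> {x. a \<bullet> x = b}) = aff_dim E - 1"
proof -
  let ?H = "{x. a \<bullet> x = b}"
  have ne: "rel_interior E \<inter> ?H \<noteq> {}"
    using convex_rel_interior_Int_hyperplane_nonempty[OF assms] .
  have aff: "affine (affine hull E \<inter> ?H)"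
    by (simp add: affine_Int affine_hyperplane)
  have "openin (top_of_set (affine hull E \<inter> ?H)) (rel_interior E \<inter> ?H)"
  proof -
    obtain U where "open U" "rel_interior E = affine hull E \<inter> U"
      using openin_rel_interior[of E] unfolding openin_open by blast
    then show ?thesis unfolding openin_open by (intro exI[of _ U]) blast
  qed
  then have hull: "affine hull (rel_interior E \<inter> ?H) = affine hull E \<inter> ?H"
    using affine_hull_openin[of "affine hull E \<inter> ?H" "rel_interior E \<inter> ?H"] ne aff
    by (simp add: hull_same)
  have "aff_dim (affine hull E \<inter> ?H) = aff_dim (rel_interior E \<inter> ?H)"
    using aff_dim_affine_hull[of "rel_interior E \<inter> ?H"] hull by simp
  also have "\<dots> \<le> aff_dim (E \<inter> ?H)"
    using rel_interior_subset[of E] by (intro aff_dim_subset) blast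
  finally have "aff_dim (E \<inter> ?H) = aff_dim (affine hull E \<inter> ?H)"
    using hull_subset[of E affine] aff_dim_subset[of "E \<inter> ?H" "affine hull E \<inter> ?H"] by auto
  moreover have "affine hull E \<inter> ?H \<noteq> {}" "\<not> affine hull E \<subseteq> ?H"
    using assms(2) ne rel_interior_subset[of E] hull_subset[of E affine] by fastforce+
  ultimately show ?thesis
    using aff_dim_affine_Int_hyperplane[of "affine hull E" a b] by (simp add: affine_affine_hull)
qed

section \<open>Faces and vertices of a polytope\<close>

text \<open>Take a minimal face containing \<open>z\<close>: if \<open>z\<close> were on its
  relative boundary, one of its facets would be a smaller face through \<open>z\<close>.\<close>

lemma polytope_point_in_rel_interior_of_face:
  fixes P :: "'a::euclidean_space set"
  assumes "polytope P" "z \<in> P"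
  obtains E where "E face_of P" "z \<in> rel_interior E"
proof -
  have "finite {E. E face_of P \<and> z \<in> E}"
    using finite_polytope_faces[OF assms(1)] by (rule rev_finite_subset) auto
  moreover have "P \<in> {E. E face_of P \<and> z \<in> E}"
    using assms by (simp add: face_of_refl polytope_imp_convex)
  ultimately obtain E where E: "E face_of P" "z \<in> E"
    and min: "\<And>E'. E' face_of P \<Longrightarrow> z \<in> E' \<Longrightarrow> E' \<subseteq> E \<Longrightarrow> E' = E"
    using finite_has_minimal[of "{E. E face_of P \<and> z \<in> E}"] by blast
  have "polyhedron E"
    using E assms face_of_polytope_polytope polytope_imp_polyhedron by blast
  have "z \<in> rel_interior E"
  proof (rule ccontr)
    assume "z \<notin> rel_interior E"
    then obtain D where D: "D facet_of E" "z \<in> D"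
      using rel_boundary_of_polyhedron[OF \<open>polyhedron E\<close>] E by blast
    then have "D face_of P" "D \<subseteq> E"
      using E facet_of_imp_face_of face_of_trans facet_of_imp_subset by blast+
    then show False using min D by fastforce
  qed
  with E that show thesis by blast
qed

lemma polytope_subset_halfspace_lt:
  fixes E :: "'a::euclidean_space set"
  assumes "polytope E" "\<And>v. v extreme_point_of E \<Longrightarrow> a \<bullet> v < b"
  shows "E \<subseteq> {x. a \<bullet> x < b}"
proof -
  have "convex hull {v. v extreme_point_of E} \<subseteq> {x. a \<bullet> x < b}"
    by (rule hull_minimal) (use assms convex_halfspace_lt in auto)
  then show ?thesis
    using Krein_Milman_Minkowski assms polytope_imp_compact polytope_imp_convex by blast
qed

section \<open>Faces of a single truncation\<close>

text \<open>A face is the convex hull of its vertices, so the position of the vertices relative to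
  the hyperplane fixes which sides each face reaches. This turns the vertex conditions of a
  truncation into conditions on faces, the form in which they are used below.\<close>

lemma truncation_sides:
  fixes P :: "'a::euclidean_space set"
  assumes P: "polytope P" and "is_truncation P F Q G"
  obtains a b where
    "Q = P \<inter> {x. a \<bullet> x \<le> b}" "G = P \<inter> {x. a \<bullet> x = b}"
    "\<And>v. v extreme_point_of P \<Longrightarrow> a \<bullet> v \<noteq> b"
    "\<And>E. E face_of P \<Longrightarrow> E \<inter> {x. a \<bullet> x < b} \<noteq> {} \<longleftrightarrow> \<not> E \<subseteq> F"
    "\<And>E. E face_of P \<Longrightarrow> E \<inter> {x. a \<bullet> x > b} \<noteq> {} \<longleftrightarrow> E \<inter> F \<noteq> {}"
proof -
  obtain a b where F: "F face_of P" and Q: "Q = P \<inter> {x. a \<bullet> x \<le> b}" and G: "G = P \<inter> {x. a \<bullet> x = b}"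
    and gt: "\<And>v. v extreme_point_of F \<Longrightarrow> a \<bullet> v > b"
    and lt: "\<And>v. v extreme_point_of P \<Longrightarrow> \<not> v extreme_point_of F \<Longrightarrow> a \<bullet> v < b"
    using assms(2) unfolding is_truncation_def by blast
  have v: "a \<bullet> v \<noteq> b" if "v extreme_point_of P" for v
    using gt[of v] lt[OF that] by fastforce
  have extF: "v extreme_point_of F \<longleftrightarrow> v extreme_point_of P \<and> v \<in> F" for v
    by (rule extreme_point_of_face[OF F])
  have 1: "E \<inter> {x. a \<bullet> x < b} \<noteq> {} \<longleftrightarrow> \<not> E \<subseteq> F" if E: "E face_of P" for E
  proof -
    have poly: "polytope E" using E P face_of_polytope_polytope by blast
    have extE: "v extreme_point_of E \<longleftrightarrow> v extreme_point_of P \<and> v \<in> E" for v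
      by (rule extreme_point_of_face[OF E])
    have "E \<inter> {x. a \<bullet> x < b} = {}" if "E \<subseteq> F"
    proof -
      \<comment> \<open>The upper open half-space, written as a lower one for the reversed
        normal.\<close>
      have "E \<subseteq> {x. (-a) \<bullet> x < -b}"
        using that gt by (intro polytope_subset_halfspace_lt[OF poly]) (auto simp: extE extF)
      then show ?thesis by auto
    qed
    moreover have "E \<subseteq> F" if "E \<inter> {x. a \<bullet> x < b} = {}"
    proof -
      have "{v. v extreme_point_of E} \<subseteq> F"
        using that lt extE extF by blast
      then have "convex hull {v. v extreme_point_of E} \<subseteq> F"
        by (rule hull_minimal) (rule face_of_imp_convex[OF F])
      then show ?thesis
        using Krein_Milman_Minkowski poly polytope_imp_compact polytope_imp_convex by blast
    qed
    ultimately show ?thesis by blast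
  qed
  have 2: "E \<inter> {x. a \<bullet> x > b} \<noteq> {} \<longleftrightarrow> E \<inter> F \<noteq> {}" if E: "E face_of P" for E
  proof -
    have poly: "polytope E" using E P face_of_polytope_polytope by blast
    have extE: "v extreme_point_of E \<longleftrightarrow> v extreme_point_of P \<and> v \<in> E" for v
      by (rule extreme_point_of_face[OF E])
    have "E \<inter> {x. a \<bullet> x > b} = {}" if "E \<inter> F = {}"
    proof -
      have "E \<subseteq> {x. a \<bullet> x < b}"
        using that lt by (intro polytope_subset_halfspace_lt[OF poly]) (auto simp: extE extF)
      then show ?thesis by fastforce
    qed
    moreover have "E \<inter> {x. a \<bullet> x > b} \<noteq> {}" if ne: "E \<inter> F \<noteq> {}"
    proof -
      \<comment> \<open>As a nonempty polytope, \<open>E \<inter> F\<close> has a vertex; it is a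
        vertex of \<open>F\<close> and hence lies above the hyperplane.\<close>
      have EF: "E \<inter> F face_of P" using E F face_of_Int by blast
      then have "polytope (E \<inter> F)" using P face_of_polytope_polytope by blast
      then obtain v where "v extreme_point_of (E \<inter> F)"
        using ne extreme_point_exists_convex polytope_imp_compact polytope_imp_convex by metis
      then have "v \<in> E" "v extreme_point_of F"
        using extreme_point_of_face[OF EF] extF by auto
      then show ?thesis using gt by blast
    qed
    ultimately show ?thesis by blast
  qed
  show thesis using that[OF Q G v 1 2] by blast
qed

lemma polytope_truncation:
  assumes "polytope P" "is_truncation P F Q G"
  shows "polytope Q"
  using truncation_sides[OF assms] by (metis assms(1) polyhedron_halfspace_le polytope_Int_polyhedron)

lemma truncation_facet_subset:
  assumes "is_truncation P F Q G"
  shows "G \<subseteq> Q" "Q \<subseteq> P"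
  using assms unfolding is_truncation_def by auto

lemma truncation_facet_face_of:
  assumes "polytope P" "is_truncation P F Q G"
  shows "G face_of Q"
proof -
  obtain a b where Q: "Q = P \<inter> {x. a \<bullet> x \<le> b}" and G: "G = P \<inter> {x. a \<bullet> x = b}"
    using truncation_sides[OF assms] by metis
  have "convex Q"
    using assms polytope_truncation polytope_imp_convex by blast
  then have "Q \<inter> {x. a \<bullet> x = b} face_of Q"
    by (rule face_of_Int_supporting_hyperplane_le) (use Q in auto)
  moreover have "Q \<inter> {x. a \<bullet> x = b} = G" using Q G by auto
  ultimately show ?thesis by simp
qed

text \<open>A face that meets \<open>F\<close> without lying in it has points on both sides, hence
  crosses the hyperplane. A face that misses \<open>F\<close> has nothing above; since no vertex
  lies on the hyperplane, all its vertices, and so all its points, are strictly below.\<close>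

lemma truncation_facet_Int_nonempty_iff:
  assumes P: "polytope P" and T: "is_truncation P F Q G" and E: "E face_of P" "\<not> E \<subseteq> F"
  shows "E \<inter> G \<noteq> {} \<longleftrightarrow> E \<inter> F \<noteq> {}"
proof -
  obtain a b where G: "G = P \<inter> {x. a \<bullet> x = b}"
    and v: "\<And>v. v extreme_point_of P \<Longrightarrow> a \<bullet> v \<noteq> b"
    and lt: "\<And>E. E face_of P \<Longrightarrow> E \<inter> {x. a \<bullet> x < b} \<noteq> {} \<longleftrightarrow> \<not> E \<subseteq> F"
    and gt: "\<And>E. E face_of P \<Longrightarrow> E \<inter> {x. a \<bullet> x > b} \<noteq> {} \<longleftrightarrow> E \<inter> F \<noteq> {}"
    using truncation_sides[OF P T] by metis
  have cE: "convex E" and EP: "E \<subseteq> P" and pE: "polytope E"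
    using E P face_of_imp_convex face_of_imp_subset face_of_polytope_polytope by blast+
  show ?thesis
  proof
    assume "E \<inter> F \<noteq> {}"
    then have "rel_interior E \<inter> {x. a \<bullet> x = b} \<noteq> {}"
      using convex_rel_interior_Int_hyperplane_nonempty[OF cE] lt[OF E(1)] gt[OF E(1)] E(2) by blast
    then show "E \<inter> G \<noteq> {}" using rel_interior_subset EP G by fast
  next
    assume EG: "E \<inter> G \<noteq> {}"
    show "E \<inter> F \<noteq> {}"
    proof (rule ccontr)
      assume "\<not> E \<inter> F \<noteq> {}"
      then have le: "\<And>x. x \<in> E \<Longrightarrow> a \<bullet> x \<le> b" using gt[OF E(1)] by fastforce
      have "a \<bullet> v < b" if "v extreme_point_of E" for v
        using that le[of v] v[of v] extreme_point_of_face[OF E(1), of v] by fastforce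
      then have "E \<subseteq> {x. a \<bullet> x < b}" using polytope_subset_halfspace_lt[OF pE] by blast
      then show False using EG G by auto
    qed
  qed
qed

text \<open>The slice contains a relative interior point of \<open>E\<close>, and a face
  \<open>E'\<close> through such a point contains all of \<open>E\<close>. The flags compare because
  \<open>E\<close> has a point strictly below the hyperplane, which belongs to \<open>Q\<close> but
  not to \<open>G\<close>.\<close>

lemma truncation_face_subset_iff:
  assumes P: "polytope P" and T: "is_truncation P F Q G"
    and E: "E face_of P" "\<not> E \<subseteq> F" "s \<Longrightarrow> E \<inter> F \<noteq> {}"
    and E': "E' face_of P"
  shows "E \<inter> (if s then G else Q) \<subseteq> E' \<inter> (if s' then G else Q) \<longleftrightarrow> E \<subseteq> E' \<and> (s' \<longrightarrow> s)"
proof -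
  obtain a b where Q: "Q = P \<inter> {x. a \<bullet> x \<le> b}" and G: "G = P \<inter> {x. a \<bullet> x = b}"
    and lt: "\<And>E. E face_of P \<Longrightarrow> E \<inter> {x. a \<bullet> x < b} \<noteq> {} \<longleftrightarrow> \<not> E \<subseteq> F"
    and gt: "\<And>E. E face_of P \<Longrightarrow> E \<inter> {x. a \<bullet> x > b} \<noteq> {} \<longleftrightarrow> E \<inter> F \<noteq> {}"
    using truncation_sides[OF P T] by metis
  have cE: "convex E" and EP: "E \<subseteq> P"
    using E face_of_imp_convex face_of_imp_subset by blast+
  have below: "E \<inter> {x. a \<bullet> x < b} \<noteq> {}" using lt E by blast
  \<comment> \<open>For \<open>s\<close> true the point is found on the hyperplane, otherwise
    strictly below it.\<close>
  have meet: "rel_interior E \<inter> (if s then G else Q) \<noteq> {}"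
  proof (cases s)
    case True
    then have "E \<inter> {x. a \<bullet> x > b} \<noteq> {}" using gt E by blast
    from convex_rel_interior_Int_hyperplane_nonempty[OF cE below this]
    show ?thesis using True G rel_interior_subset EP by fastforce
  next
    case False
    from convex_rel_interior_Int_open_nonempty[OF cE open_halfspace_lt below]
    show ?thesis using False Q rel_interior_subset[of E] EP by fastforce
  qed
  show ?thesis
  proof
    assume sub: "E \<inter> (if s then G else Q) \<subseteq> E' \<inter> (if s' then G else Q)"
    have "E' \<inter> rel_interior E \<noteq> {}"
      using meet sub rel_interior_subset[of E] by blast
    then have "E \<subseteq> E'" using subset_of_face_of[OF E' EP] by blast
    moreover have s if s'
    proof (rule ccontr)
      assume "\<not> s"
      then have "E \<inter> Q \<subseteq> G" using sub that by auto
      then show False using below EP Q G by fastforce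
    qed
    ultimately show "E \<subseteq> E' \<and> (s' \<longrightarrow> s)" by blast
  next
    assume "E \<subseteq> E' \<and> (s' \<longrightarrow> s)"
    then show "E \<inter> (if s then G else Q) \<subseteq> E' \<inter> (if s' then G else Q)"
      using truncation_facet_subset[OF T] by auto
  qed
qed

text \<open>Given \<open>X\<close>, pick a relative interior point \<open>z\<close> of it and the
  face \<open>E\<close> of \<open>P\<close> having \<open>z\<close> in its relative interior.
  Depending on whether \<open>z\<close> is below or on the hyperplane, \<open>z\<close> is also a
  relative interior point of \<open>E \<inter> Q\<close> or of \<open>E \<inter> G\<close>, and two
  faces of \<open>Q\<close> with a common relative interior point coincide.\<close>

lemma nonempty_face_of_truncation_iff:
  assumes P: "polytope P" and T: "is_truncation P F Q G"
  shows "X face_of Q \<and> X \<noteq> {} \<longleftrightarrow>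
    (\<exists>E s. E face_of P \<and> \<not> E \<subseteq> F \<and> (s \<longrightarrow> E \<inter> F \<noteq> {}) \<and> X = E \<inter> (if s then G else Q))"
    (is "?L \<longleftrightarrow> ?R")
proof -
  obtain a b where Q: "Q = P \<inter> {x. a \<bullet> x \<le> b}" and G: "G = P \<inter> {x. a \<bullet> x = b}"
    and v: "\<And>v. v extreme_point_of P \<Longrightarrow> a \<bullet> v \<noteq> b"
    and lt: "\<And>E. E face_of P \<Longrightarrow> E \<inter> {x. a \<bullet> x < b} \<noteq> {} \<longleftrightarrow> \<not> E \<subseteq> F"
    and gt: "\<And>E. E face_of P \<Longrightarrow> E \<inter> {x. a \<bullet> x > b} \<noteq> {} \<longleftrightarrow> E \<inter> F \<noteq> {}"
    using truncation_sides[OF P T] by metis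
  have cQ: "convex Q"
    using P T polytope_truncation polytope_imp_convex by blast
  have faces: "E \<inter> Q face_of Q" "E \<inter> G face_of Q" if "E face_of P" for E
  proof -
    show EQ: "E \<inter> Q face_of Q"
      using face_of_slice[OF that cQ] truncation_facet_subset[OF T] by (simp add: Int_absorb1)
    then have "(E \<inter> Q) \<inter> G face_of Q"
      using truncation_facet_face_of[OF P T] face_of_Int by blast
    moreover have "(E \<inter> Q) \<inter> G = E \<inter> G" using truncation_facet_subset[OF T] by blast
    ultimately show "E \<inter> G face_of Q" by simp
  qed
  show ?thesis
  proof
    assume ?R
    then obtain E s where E: "E face_of P" "\<not> E \<subseteq> F" "s \<Longrightarrow> E \<inter> F \<noteq> {}"
      and X: "X = E \<inter> (if s then G else Q)" by blast
    have "X face_of Q" using faces[OF E(1)] X by auto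
    moreover have "E \<inter> G \<noteq> {}" if s
      using truncation_facet_Int_nonempty_iff[OF P T E(1,2)] E(3)[OF that] by blast
    moreover have "E \<inter> Q \<noteq> {}"
      using lt[OF E(1)] E(2) Q face_of_imp_subset[OF E(1)] by fastforce
    ultimately show ?L using X by auto
  next
    assume L: ?L
    then have "convex X" using face_of_imp_convex by blast
    then obtain z where z: "z \<in> rel_interior X" using L rel_interior_eq_empty by blast
    then have zX: "z \<in> X" using rel_interior_subset by blast
    then have zP: "z \<in> P" "a \<bullet> z \<le> b" using L face_of_imp_subset Q by auto
    obtain E where E: "E face_of P" and zE: "z \<in> rel_interior E"
      using polytope_point_in_rel_interior_of_face[OF P zP(1)] .
    have cE: "convex E" and EP: "E \<subseteq> P" and pE: "polytope E"
      using E P face_of_imp_convex face_of_imp_subset face_of_polytope_polytope by blast+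
    have zE': "z \<in> E" using zE rel_interior_subset by blast
    show ?R
    proof (cases "a \<bullet> z < b")
      case True
      have "z \<in> interior {x. a \<bullet> x \<le> b}"
        by (rule interiorI[of "{x. a \<bullet> x < b}"]) (use True open_halfspace_lt in auto)
      then have "z \<in> rel_interior {x. a \<bullet> x \<le> b}"
        using interior_subset_rel_interior by blast
      then have "z \<in> rel_interior (E \<inter> {x. a \<bullet> x \<le> b})"
        using convex_rel_interior_inter_two[OF cE convex_halfspace_le, of a b] zE by blast
      moreover have "E \<inter> {x. a \<bullet> x \<le> b} = E \<inter> Q" using EP Q by blast
      ultimately have "X = E \<inter> Q"
        using face_of_eq[of X Q "E \<inter> Q"] L faces(1)[OF E] z by auto
      moreover have "\<not> E \<subseteq> F" using lt[OF E] True zE' by blast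
      ultimately show ?R using E by (intro exI[of _ E] exI[of _ False]) auto
    next
      case False
      then have zb: "a \<bullet> z = b" using zP by simp
      then have "z \<in> rel_interior (E \<inter> {x. a \<bullet> x = b})"
        using convex_affine_rel_interior_Int[OF cE affine_hyperplane, of a b] zE by blast
      moreover have "E \<inter> {x. a \<bullet> x = b} = E \<inter> G" using EP G by blast
      ultimately have X: "X = E \<inter> G"
        using face_of_eq[of X Q "E \<inter> G"] L faces(2)[OF E] z by auto
      \<comment> \<open>It remains to see that \<open>E\<close> reaches both sides. Otherwise the
        hyperplane would support \<open>E\<close> at the relative interior point \<open>z\<close>
        and thus contain \<open>E\<close>, contradicting that the vertex \<open>w\<close> is off
        it.\<close>
      obtain w where "w extreme_point_of E"
        using extreme_point_exists_convex pE polytope_imp_compact polytope_imp_convex zE' by blast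
      then have w: "w \<in> E" "a \<bullet> w \<noteq> b"
        using extreme_point_of_face[OF E] v by auto
      have one_sided: "E \<subseteq> {x. a \<bullet> x = b}" if "E \<inter> {x. a \<bullet> x = b} face_of E"
        using subset_of_face_of[OF that] zE zE' zb by blast
      have "E \<inter> {x. a \<bullet> x < b} \<noteq> {}"
      proof
        assume "E \<inter> {x. a \<bullet> x < b} = {}"
        then have "E \<inter> {x. a \<bullet> x = b} face_of E"
          by (intro face_of_Int_supporting_hyperplane_ge cE) force
        then show False using one_sided w by blast
      qed
      moreover have "E \<inter> {x. a \<bullet> x > b} \<noteq> {}"
      proof
        assume "E \<inter> {x. a \<bullet> x > b} = {}"
        then have "E \<inter> {x. a \<bullet> x = b} face_of E"
          by (intro face_of_Int_supporting_hyperplane_le cE) force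
        then show False using one_sided w by blast
      qed
      ultimately show ?R using E lt gt X by (intro exI[of _ E] exI[of _ True]) auto
    qed
  qed
qed


section \<open>Facets containing a face\<close>

text \<open>A nonempty proper face is the intersection of the facets that contain it.\<close>

lemma inj_on_facets_containing:
  fixes P :: "'a::euclidean_space set"
  assumes "polytope P"
  shows "inj_on (\<lambda>E. {D. D facet_of P \<and> E \<subseteq> D}) {E. E face_of P \<and> E \<noteq> {}}"
proof (rule inj_onI)
  have poly: "polyhedron P" using assms polytope_imp_polyhedron by blast
  have le: "E' \<subseteq> E" if E: "E face_of P" "E \<noteq> {}" and E': "E' face_of P"
    and eq: "{D. D facet_of P \<and> E \<subseteq> D} = {D. D facet_of P \<and> E' \<subseteq> D}" for E E'
  proof (cases "E = P")
    case True
    then show ?thesis using face_of_imp_subset[OF E'] by blast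
  next
    case False
    have "E = \<Inter>{D. D facet_of P \<and> E' \<subseteq> D}"
      using face_of_polyhedron[OF poly E False] eq by simp
    then show ?thesis by blast
  qed
  fix E E'
  assume "E \<in> {E. E face_of P \<and> E \<noteq> {}}" "E' \<in> {E. E face_of P \<and> E \<noteq> {}}"
    "{D. D facet_of P \<and> E \<subseteq> D} = {D. D facet_of P \<and> E' \<subseteq> D}"
  then show "E = E'" using le[of E E'] le[of E' E] by simp
qed

text \<open>Induction on the codimension. Let \<open>D\<close> be a minimal face strictly above
  \<open>E\<close>. Then \<open>E\<close> is a facet of \<open>D\<close>, so the dimension grows by
  exactly one, while at least one containing facet is lost since the containing facets determine the
  face.\<close>

lemma aff_dim_le_card_facets_containing:
  fixes P :: "'a::euclidean_space set"
  assumes P: "polytope P" and "E face_of P" "E \<noteq> {}"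
  shows "aff_dim P \<le> aff_dim E + int (card {D. D facet_of P \<and> E \<subseteq> D})"
  using assms(2,3)
proof (induction "nat (aff_dim P - aff_dim E)" arbitrary: E rule: less_induct)
  case less
  show ?case
  proof (cases "E = P")
    case False
    have "finite {D. D face_of P \<and> E \<subset> D}"
      using finite_polytope_faces[OF P] by (rule rev_finite_subset) auto
    moreover have "P \<in> {D. D face_of P \<and> E \<subset> D}"
      using less.prems False P face_of_imp_subset by (auto simp: face_of_refl polytope_imp_convex)
    ultimately obtain D where "D \<in> {D. D face_of P \<and> E \<subset> D}"
      and "\<forall>C \<in> {D. D face_of P \<and> E \<subset> D}. C \<subseteq> D \<longrightarrow> D = C"
      using finite_has_minimal[of "{D. D face_of P \<and> E \<subset> D}"] by auto
    then have D: "D face_of P" "E \<subset> D"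
      and min: "\<And>C. C face_of P \<Longrightarrow> E \<subset> C \<Longrightarrow> C \<subseteq> D \<Longrightarrow> C = D"
      by auto
    have "polyhedron D"
      using D P face_of_polytope_polytope polytope_imp_polyhedron by blast
    moreover have "E face_of D"
      using less.prems(1) D face_of_imp_subset by (intro face_of_subset[of E P D]) auto
    ultimately obtain C where C: "C facet_of D" "E \<subseteq> C"
      using face_of_polyhedron_subset_facet[of D E] less.prems(2) D(2) by blast
    have "C face_of P" "C \<subseteq> D" "C \<noteq> D"
      using C(1) D(1) facet_of_imp_face_of face_of_trans facet_of_imp_subset facet_of_irrefl by blast+
    then have "E = C" using min C(2) by blast
    then have dim: "aff_dim E = aff_dim D - 1" using C(1) by (simp add: facet_of_def)
    moreover have "aff_dim D \<le> aff_dim P"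
      using D(1) by (simp add: aff_dim_subset face_of_imp_subset)
    moreover have "D \<noteq> {}" using D(2) by blast
    ultimately have IH: "aff_dim P \<le> aff_dim D + int (card {C. C facet_of P \<and> D \<subseteq> C})"
      using less.hyps[of D] D(1) by simp
    have "{C. C facet_of P \<and> D \<subseteq> C} \<noteq> {C. C facet_of P \<and> E \<subseteq> C}"
      using inj_onD[OF inj_on_facets_containing[OF P], of D E] D less.prems by auto
    then have "{C. C facet_of P \<and> D \<subseteq> C} \<subset> {C. C facet_of P \<and> E \<subseteq> C}"
      using D(2) by blast
    moreover have "finite {C. C facet_of P \<and> E \<subseteq> C}"
      using finite_polytope_facets[OF P] by (rule rev_finite_subset) auto
    ultimately have "card {C. C facet_of P \<and> D \<subseteq> C} < card {C. C facet_of P \<and> E \<subseteq> C}"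
      by (rule psubset_card_mono[rotated])
    then show ?thesis using IH dim by linarith
  qed simp
qed

section \<open>The new facet at a vertex is a simplex\<close>

text \<open>The vertex \<open>v\<close> is a face of \<open>Q\<close>, so it is a slice of some face
  \<open>E\<close> of \<open>P\<close>. Cutting \<open>E\<close> by the hyperplane lowers its
  dimension by one and leaves a point, so \<open>E\<close> is an edge.\<close>

lemma vertex_of_truncation_facet:
  fixes P :: "'a::euclidean_space set"
  assumes P: "polytope P" and T: "is_truncation P F Q G" and v: "v extreme_point_of G"
  obtains E where "E face_of P" "aff_dim E = 1" "E \<inter> F \<noteq> {}" "\<not> E \<subseteq> F" "E \<inter> G = {v}"
proof -
  obtain a b where G: "G = P \<inter> {x. a \<bullet> x = b}"
    and lt: "\<And>E. E face_of P \<Longrightarrow> E \<inter> {x. a \<bullet> x < b} \<noteq> {} \<longleftrightarrow> \<not> E \<subseteq> F"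
    and gt: "\<And>E. E face_of P \<Longrightarrow> E \<inter> {x. a \<bullet> x > b} \<noteq> {} \<longleftrightarrow> E \<inter> F \<noteq> {}"
    using truncation_sides[OF P T] by metis
  have PP: "P face_of P"
    using P by (simp add: face_of_refl polytope_imp_convex)
  have "{v} face_of Q"
    using v truncation_facet_face_of[OF P T] face_of_singleton face_of_trans by blast
  then obtain E s where E: "E face_of P" "\<not> E \<subseteq> F" "s \<Longrightarrow> E \<inter> F \<noteq> {}"
    and eq: "{v} = E \<inter> (if s then G else Q)"
    using nonempty_face_of_truncation_iff[OF P T, of "{v}"] by blast
  have "v \<in> G" using v by (simp add: extreme_point_of_def)
  \<comment> \<open>Comparison with \<open>G\<close>, the slice of \<open>P\<close> itself with flag
    true, forces \<open>s\<close>.\<close>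
  then have "E \<inter> (if s then G else Q) \<subseteq> P \<inter> (if True then G else Q)"
    using eq G by auto
  then have s: s
    using truncation_face_subset_iff[OF P T E PP, of s True] by blast
  then have EG: "E \<inter> G = {v}" and EF: "E \<inter> F \<noteq> {}" using eq E(3) by auto
  have "E \<inter> {x. a \<bullet> x = b} = {v}"
    using EG G face_of_imp_subset[OF E(1)] by blast
  then have "aff_dim E = 1"
    using aff_dim_Int_separating_hyperplane[OF face_of_imp_convex[OF E(1)], of a b]
      lt[OF E(1)] gt[OF E(1)] E(2) EF by simp
  then show thesis using that E EG EF by blast
qed

lemma aff_dim_truncation_facet:
  fixes P :: "'a::euclidean_space set"
  assumes P: "polytope P" and T: "is_truncation P F Q G"
  shows "aff_dim G = aff_dim P - 1"
proof -
  obtain a b where G: "G = P \<inter> {x. a \<bullet> x = b}"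
    and lt: "\<And>E. E face_of P \<Longrightarrow> E \<inter> {x. a \<bullet> x < b} \<noteq> {} \<longleftrightarrow> \<not> E \<subseteq> F"
    and gt: "\<And>E. E face_of P \<Longrightarrow> E \<inter> {x. a \<bullet> x > b} \<noteq> {} \<longleftrightarrow> E \<inter> F \<noteq> {}"
    using truncation_sides[OF P T] by metis
  have cP: "convex P" using P polytope_imp_convex by blast
  have "F \<subseteq> P" "F \<noteq> {}" "F \<noteq> P"
    using T face_of_imp_subset unfolding is_truncation_def by blast+
  then have "P \<inter> {x. a \<bullet> x < b} \<noteq> {}" "P \<inter> {x. a \<bullet> x > b} \<noteq> {}"
    using lt[OF face_of_refl[OF cP]] gt[OF face_of_refl[OF cP]] by blast+
  then show ?thesis
    using aff_dim_Int_separating_hyperplane[OF cP] G by blast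
qed

lemma simple_polytope_truncation_vertex_simplex:
  fixes P :: "'a::euclidean_space set"
  assumes simple: "simple_polytope P" and p: "p extreme_point_of P" and T: "is_truncation P {p} Q G"
  shows "(aff_dim P - 1) simplex G"
proof -
  have P: "polytope P" using simple by (simp add: simple_polytope_def)
  define \<Phi> where "\<Phi> E = {D. D facet_of P \<and> E \<subseteq> D}" for E
  define V where "V = {v. v extreme_point_of G}"
  have fin: "finite (\<Phi> E)" for E
    unfolding \<Phi>_def using finite_polytope_facets[OF P] by (rule rev_finite_subset) auto
  have card_p: "int (card (\<Phi> {p})) = aff_dim P"
    using simple p by (simp add: \<Phi>_def simple_polytope_def)
  have inj: "E = E'" if "E face_of P" "E \<noteq> {}" "E' face_of P" "E' \<noteq> {}" "\<Phi> E = \<Phi> E'" for E E'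
    using inj_onD[OF inj_on_facets_containing[OF P], of E E'] that by (simp add: \<Phi>_def)
  have "\<exists>E. E face_of P \<and> aff_dim E = 1 \<and> p \<in> E \<and> E \<noteq> {p} \<and> E \<inter> G = {v}" if "v \<in> V" for v
    using vertex_of_truncation_facet[OF P T, of v] that unfolding V_def
    by (metis Int_insert_right_if0 inf_bot_right mem_Collect_eq order_refl)
  then obtain e where e: "\<And>v. v \<in> V \<Longrightarrow> e v face_of P" "\<And>v. v \<in> V \<Longrightarrow> aff_dim (e v) = 1"
    "\<And>v. v \<in> V \<Longrightarrow> p \<in> e v" "\<And>v. v \<in> V \<Longrightarrow> e v \<noteq> {p}" "\<And>v. v \<in> V \<Longrightarrow> e v \<inter> G = {v}"
    by metis
  \<comment> \<open>The facets determine the edge, and the edge determines \<open>v\<close> as its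
    only point in \<open>G\<close>.\<close>
  have "inj_on (\<lambda>v. \<Phi> (e v)) V"
    by (rule inj_onI) (metis e empty_iff inj singleton_inject)
  moreover have "(\<lambda>v. \<Phi> (e v)) ` V \<subseteq> (\<lambda>D. \<Phi> {p} - {D}) ` \<Phi> {p}"
  proof
    fix A
    assume "A \<in> (\<lambda>v. \<Phi> (e v)) ` V"
    then obtain v where v: "v \<in> V" and A: "A = \<Phi> (e v)" by blast
    have "A \<noteq> \<Phi> {p}"
      using inj[of "e v" "{p}"] e(1,3,4)[OF v] p A by (auto simp: face_of_singleton)
    moreover have sub: "A \<subseteq> \<Phi> {p}"
      using e(3)[OF v] by (auto simp: A \<Phi>_def)
    \<comment> \<open>\<open>D\<close> is a facet at \<open>p\<close> that misses part of the edge.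
      An edge lies in at least \<open>aff_dim P - 1\<close> facets, so \<open>A\<close> must be
      everything except \<open>D\<close>.\<close>
    ultimately obtain D where D: "D \<in> \<Phi> {p}" "A \<subseteq> \<Phi> {p} - {D}" by blast
    have "aff_dim P \<le> 1 + int (card A)"
      using aff_dim_le_card_facets_containing[OF P e(1)[OF v]] e(2,3)[OF v] by (auto simp: A \<Phi>_def)
    moreover have "card (\<Phi> {p} - {D}) = card (\<Phi> {p}) - 1"
      using D(1) by simp
    ultimately have "card (\<Phi> {p} - {D}) \<le> card A" using card_p by linarith
    then have "A = \<Phi> {p} - {D}" using card_seteq[OF _ D(2)] fin by blast
    then show "A \<in> (\<lambda>D. \<Phi> {p} - {D}) ` \<Phi> {p}" using D(1) by blast
  qed
  ultimately have "card V \<le> card ((\<lambda>D. \<Phi> {p} - {D}) ` \<Phi> {p})"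
    using fin by (intro card_inj_on_le) auto
  also have "\<dots> \<le> card (\<Phi> {p})" using fin by (rule card_image_le)
  finally have card_le: "int (card V) \<le> aff_dim P" using card_p by linarith
  have pG: "polytope G"
    using truncation_facet_face_of[OF P T] polytope_truncation[OF P T] face_of_polytope_polytope by blast
  then have G: "G = convex hull V"
    unfolding V_def using Krein_Milman_Minkowski polytope_imp_compact polytope_imp_convex by blast
  have finV: "finite V"
    unfolding V_def using finite_polyhedron_extreme_points polytope_imp_polyhedron[OF pG] by blast
  \<comment> \<open>Spanning this dimension takes at least \<open>aff_dim P\<close> points. With the
    upper bound on \<open>card V\<close> the count is exact, which forces affine
    independence.\<close>
  have dim: "aff_dim V = aff_dim P - 1"
    using aff_dim_truncation_facet[OF P T] aff_dim_convex_hull[of V] G by simp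
  then have card: "int (card V) = aff_dim P"
    using aff_dim_le_card[OF finV] card_le by linarith
  then have "\<not> affine_dependent V"
    unfolding affine_independent_iff_card using dim card finV by linarith
  then show ?thesis
    using simplex_convex_hull[of V] card G by simp
qed

section \<open>Complementary faces of a simplex\<close>

lemma card_extreme_points_simplex:
  assumes "m simplex S"
  shows "finite {v. v extreme_point_of S}" "int (card {v. v extreme_point_of S}) = m + 1"
proof -
  obtain C where C: "\<not> affine_dependent C" "int (card C) = m + 1" "S = convex hull C"
    using assms unfolding simplex_def by blast
  then have "{v. v extreme_point_of S} = C"
    by (simp add: extreme_point_of_convex_hull_affine_independent)
  then show "finite {v. v extreme_point_of S}" "int (card {v. v extreme_point_of S}) = m + 1"
    using C aff_independent_finite by auto
qed

text \<open>The vertex sets of \<open>S\<close> and \<open>T\<close> are disjoint with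
  \<open>(i + 1) + (j + 1) = m + 1\<close> elements in total, so they exhaust the vertices of
  \<open>G\<close>. A face missing \<open>T\<close> therefore has all its vertices in
  \<open>S\<close>.\<close>

lemma face_subset_complementary_simplex_faces:
  fixes G :: "'a::euclidean_space set"
  assumes G: "m simplex G" and S: "S face_of G" "i simplex S" and T: "T face_of G" "j simplex T"
    and "i + j + 1 = m" "S \<inter> T = {}" and D: "D face_of G"
  shows "D \<subseteq> S \<longleftrightarrow> D \<inter> T = {}"
proof
  assume "D \<subseteq> S"
  then show "D \<inter> T = {}" using assms by blast
next
  assume DT: "D \<inter> T = {}"
  let ?ext = "\<lambda>X. {v. v extreme_point_of X}"
  have ext: "v extreme_point_of X \<longleftrightarrow> v extreme_point_of G \<and> v \<in> X" if "X face_of G" for X v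
    by (rule extreme_point_of_face[OF that])
  have "?ext S \<inter> ?ext T = {}"
    using assms by (auto simp: ext)
  then have "int (card (?ext S \<union> ?ext T)) = int (card (?ext G))"
    using card_extreme_points_simplex[OF G] card_extreme_points_simplex[OF S(2)]
      card_extreme_points_simplex[OF T(2)] assms(6) by (simp add: card_Un_disjoint)
  moreover have "?ext S \<union> ?ext T \<subseteq> ?ext G"
    using ext S T by blast
  ultimately have "?ext S \<union> ?ext T = ?ext G"
    using card_subset_eq[OF card_extreme_points_simplex(1)[OF G]] by auto
  then have "?ext D \<subseteq> S"
    using DT ext[OF D] ext[OF S(1)] ext[OF T(1)] by blast
  then have "convex hull (?ext D) \<subseteq> S"
    by (rule hull_minimal) (rule face_of_imp_convex[OF S(1)])
  moreover have "polytope D"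
    using D G simplex_imp_polytope face_of_polytope_polytope by blast
  ultimately show "D \<subseteq> S"
    using Krein_Milman_Minkowski polytope_imp_compact polytope_imp_convex by blast
qed

section \<open>Combinatorial equivalence through a common index set\<close>

text \<open>The isomorphism is \<psi> after a choice of index for each nonempty face; the choice is
  immaterial, since two indices with equal \<phi>-images have equal \<psi>-images. The empty face
  carries no index and is sent to the empty face.\<close>

lemma combinatorially_equivalentI:
  assumes \<phi>: "\<phi> ` I = {X. X face_of P \<and> X \<noteq> {}}" and \<psi>: "\<psi> ` I = {X. X face_of Q \<and> X \<noteq> {}}"
    and sub: "\<And>i j. i \<in> I \<Longrightarrow> j \<in> I \<Longrightarrow> \<phi> i \<subseteq> \<phi> j \<longleftrightarrow> \<psi> i \<subseteq> \<psi> j"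
  shows "combinatorially_equivalent P Q"
proof -
  define g where "g = inv_into I \<phi>"
  define f where "f X = (if X = {} then {} else \<psi> (g X))" for X
  have g: "g X \<in> I" "\<phi> (g X) = X" if "X face_of P" "X \<noteq> {}" for X
  proof -
    have "X \<in> \<phi> ` I" using that \<phi> by blast
    then show "g X \<in> I" "\<phi> (g X) = X"
      unfolding g_def by (rule inv_into_into, rule f_inv_into_f)
  qed
  have \<psi>I: "\<psi> i face_of Q" "\<psi> i \<noteq> {}" if "i \<in> I" for i
    using \<psi> that by blast+
  have sub_f: "X \<subseteq> X' \<longleftrightarrow> f X \<subseteq> f X'" if "X face_of P" "X' face_of P" for X X'
  proof (cases "X = {} \<or> X' = {}")
    case True
    then show ?thesis using \<psi>I(2)[OF g(1), of X] that(1) by (auto simp: f_def)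
  next
    case False
    then show ?thesis
      using sub[OF g(1) g(1), of X X'] g(2)[of X] g(2)[of X'] that by (simp add: f_def)
  qed
  have "inj_on f {X. X face_of P}"
    by (rule inj_onI) (metis sub_f mem_Collect_eq order_refl subset_antisym)
  moreover have "f ` {X. X face_of P} = {X. X face_of Q}"
  proof
    show "f ` {X. X face_of P} \<subseteq> {X. X face_of Q}"
      using g(1) \<psi>I(1) by (auto simp: f_def)
    show "{X. X face_of Q} \<subseteq> f ` {X. X face_of P}"
    proof
      fix Y
      assume Y: "Y \<in> {X. X face_of Q}"
      show "Y \<in> f ` {X. X face_of P}"
      proof (cases "Y = {}")
        case True
        then show ?thesis by (intro image_eqI[of _ _ "{}"]) (auto simp: f_def)
      next
        case False
        then obtain i where i: "i \<in> I" "Y = \<psi> i" using Y \<psi> by blast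
        then have X: "\<phi> i face_of P" "\<phi> i \<noteq> {}" using \<phi> by blast+
        \<comment> \<open>The chosen index \<open>g (\<phi> i)\<close> may differ from
          \<open>i\<close>, but both have the same \<phi>-image, so \<open>sub\<close> applies in
          both directions.\<close>
        then have "\<psi> (g (\<phi> i)) = \<psi> i"
          using sub[of i "g (\<phi> i)"] sub[of "g (\<phi> i)" i] g[of "\<phi> i"] i(1) by auto
        then show ?thesis using X i by (intro image_eqI[of _ _ "\<phi> i"]) (auto simp: f_def)
      qed
    qed
  qed
  ultimately have "bij_betw f {X. X face_of P} {X. X face_of Q}"
    by (simp add: bij_betw_def)
  with sub_f show ?thesis
    unfolding combinatorially_equivalent_def by blast
qed

section \<open>Faces of two successive truncations\<close>

text \<open>Each flag has a condition of its own, so that exchanging \<open>S\<close> with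
  \<open>T\<close> and \<open>s\<close> with \<open>t\<close> is visibly a symmetry.\<close>

definition iterated_truncation_index :: "'a::euclidean_space set \<Rightarrow> 'a set \<Rightarrow> 'a set \<Rightarrow> 'a set \<Rightarrow> 'a set \<Rightarrow>
    ('a set \<times> bool \<times> bool) set" where
  "iterated_truncation_index P F G S T = {(E, s, t). E face_of P \<and> \<not> E \<subseteq> F \<and>
     (s \<longrightarrow> E \<inter> G \<inter> T \<noteq> {}) \<and> (t \<longrightarrow> E \<inter> G \<inter> S \<noteq> {})}"

definition iterated_truncation_face :: "'a::euclidean_space set \<Rightarrow> 'a set \<Rightarrow> 'a set \<Rightarrow> 'a set \<Rightarrow>
    'a set \<times> bool \<times> bool \<Rightarrow> 'a set" where
  "iterated_truncation_face Q G R N = (\<lambda>(E, s, t). (E \<inter> (if s then G else Q)) \<inter> (if t then N else R))"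

text \<open>The right-hand side is what two uses of the face description produce. It simplifies
  because \<open>S\<close> lies in \<open>G\<close>: meeting \<open>S\<close> does not depend on
  \<open>s\<close>, and a slice with \<open>s\<close> false is never inside \<open>S\<close>. For
  \<open>s\<close> true, complementarity turns not lying in \<open>S\<close> into meeting
  \<open>T\<close>, which already implies that \<open>E\<close> meets \<open>F\<close>.\<close>

lemma iterated_truncation_index_iff:
  fixes P :: "'a::euclidean_space set"
  assumes P: "polytope P" and T1: "is_truncation P F Q G" and S: "S face_of G"
    and compl: "\<forall>D. D face_of G \<longrightarrow> (D \<subseteq> S \<longleftrightarrow> D \<inter> T = {})"
  shows "(E, s, t) \<in> iterated_truncation_index P F G S T \<longleftrightarrow>
    E face_of P \<and> \<not> E \<subseteq> F \<and> (s \<longrightarrow> E \<inter> F \<noteq> {}) \<and>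
    \<not> E \<inter> (if s then G else Q) \<subseteq> S \<and> (t \<longrightarrow> E \<inter> (if s then G else Q) \<inter> S \<noteq> {})"
proof (cases "E face_of P \<and> \<not> E \<subseteq> F")
  case True
  then have E: "E face_of P" "\<not> E \<subseteq> F" by auto
  have GQ: "G \<subseteq> Q" "Q \<subseteq> P" "S \<subseteq> G"
    using truncation_facet_subset[OF T1] face_of_imp_subset[OF S] by auto
  have "convex G"
    using truncation_facet_face_of[OF P T1] face_of_imp_convex by blast
  then have "E \<inter> G face_of P \<inter> G" by (rule face_of_slice[OF E(1)])
  then have EG: "E \<inter> G face_of G" using GQ by (simp add: Int_absorb1)
  have PP: "P face_of P"
    using P by (simp add: face_of_refl polytope_imp_convex)
  have "\<not> E \<inter> Q \<subseteq> S"
  proof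
    assume "E \<inter> Q \<subseteq> S"
    \<comment> \<open>An inclusion of a slice with flag false in one with flag true contradicts the
      order criterion.\<close>
    then have "E \<inter> (if False then G else Q) \<subseteq> P \<inter> (if True then G else Q)" using GQ by auto
    then show False
      using truncation_face_subset_iff[OF P T1 E _ PP, of False True] by blast
  qed
  moreover have "E \<inter> G \<inter> S = E \<inter> Q \<inter> S" using GQ by blast
  moreover have "E \<inter> G \<inter> T \<noteq> {} \<longleftrightarrow> E \<inter> F \<noteq> {} \<and> \<not> E \<inter> G \<subseteq> S"
    using compl[rule_format, OF EG] truncation_facet_Int_nonempty_iff[OF P T1 E] by blast
  ultimately show ?thesis using E by (auto simp: iterated_truncation_index_def)
qed (auto simp: iterated_truncation_index_def)

lemma nonempty_faces_of_iterated_truncation: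
  fixes P :: "'a::euclidean_space set"
  assumes P: "polytope P" and T1: "is_truncation P F Q G" and S: "S face_of G"
    and compl: "\<forall>D. D face_of G \<longrightarrow> (D \<subseteq> S \<longleftrightarrow> D \<inter> T = {})"
    and T2: "is_truncation Q S R N"
  shows "iterated_truncation_face Q G R N ` iterated_truncation_index P F G S T = {X. X face_of R \<and> X \<noteq> {}}"
proof -
  have Q: "polytope Q" by (rule polytope_truncation[OF P T1])
  note idx = iterated_truncation_index_iff[OF P T1 S compl]
  show ?thesis
  proof (intro subset_antisym subsetI)
    fix X
    assume "X \<in> iterated_truncation_face Q G R N ` iterated_truncation_index P F G S T"
    then obtain E s t where i: "(E, s, t) \<in> iterated_truncation_index P F G S T"
      and X: "X = iterated_truncation_face Q G R N (E, s, t)" by auto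
    let ?Y = "E \<inter> (if s then G else Q)"
    note i' = i[unfolded idx]
    have "?Y face_of Q"
      using nonempty_face_of_truncation_iff[OF P T1, of ?Y] i' by blast
    then show "X \<in> {X. X face_of R \<and> X \<noteq> {}}"
      unfolding mem_Collect_eq nonempty_face_of_truncation_iff[OF Q T2]
      by (intro exI[of _ ?Y] exI[of _ t]) (use i' X in \<open>simp add: iterated_truncation_face_def\<close>)
  next
    fix X
    assume "X \<in> {X. X face_of R \<and> X \<noteq> {}}"
    then obtain Y t where Y: "Y face_of Q" "\<not> Y \<subseteq> S" "t \<longrightarrow> Y \<inter> S \<noteq> {}"
      and X: "X = Y \<inter> (if t then N else R)"
      unfolding mem_Collect_eq nonempty_face_of_truncation_iff[OF Q T2] by blast
    \<comment> \<open>\<open>Y\<close> is nonempty because it is not contained in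
      \<open>S\<close>.\<close>
    then have "Y face_of Q \<and> Y \<noteq> {}" by blast
    then obtain E s where "E face_of P" "\<not> E \<subseteq> F" "s \<longrightarrow> E \<inter> F \<noteq> {}"
      and YE: "Y = E \<inter> (if s then G else Q)"
      unfolding nonempty_face_of_truncation_iff[OF P T1] by blast
    with Y have "(E, s, t) \<in> iterated_truncation_index P F G S T"
      unfolding idx by simp
    then show "X \<in> iterated_truncation_face Q G R N ` iterated_truncation_index P F G S T"
      by (rule rev_image_eqI) (simp add: iterated_truncation_face_def X YE)
  qed
qed

lemma iterated_truncation_face_subset_iff:
  fixes P :: "'a::euclidean_space set"
  assumes P: "polytope P" and T1: "is_truncation P F Q G" and S: "S face_of G"
    and compl: "\<forall>D. D face_of G \<longrightarrow> (D \<subseteq> S \<longleftrightarrow> D \<inter> T = {})"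
    and T2: "is_truncation Q S R N"
    and i: "(E, s, t) \<in> iterated_truncation_index P F G S T" and j: "(E', s', t') \<in> iterated_truncation_index P F G S T"
  shows "iterated_truncation_face Q G R N (E, s, t) \<subseteq> iterated_truncation_face Q G R N (E', s', t') \<longleftrightarrow>
    E \<subseteq> E' \<and> (s' \<longrightarrow> s) \<and> (t' \<longrightarrow> t)"
proof -
  have Q: "polytope Q" by (rule polytope_truncation[OF P T1])
  note idx = iterated_truncation_index_iff[OF P T1 S compl]
  note i' = i[unfolded idx] and j' = j[unfolded idx]
  let ?X = "E \<inter> (if s then G else Q)" and ?X' = "E' \<inter> (if s' then G else Q)"
  have X: "?X face_of Q"
    using nonempty_face_of_truncation_iff[OF P T1, of ?X] i' by blast
  have X': "?X' face_of Q"
    using nonempty_face_of_truncation_iff[OF P T1, of ?X'] j' by blast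
  have "?X \<inter> (if t then N else R) \<subseteq> ?X' \<inter> (if t' then N else R) \<longleftrightarrow> ?X \<subseteq> ?X' \<and> (t' \<longrightarrow> t)"
    by (rule truncation_face_subset_iff[OF Q T2 X _ _ X']) (use i' in auto)
  moreover have "?X \<subseteq> ?X' \<longleftrightarrow> E \<subseteq> E' \<and> (s' \<longrightarrow> s)"
    by (rule truncation_face_subset_iff[OF P T1]) (use i' j' in auto)
  ultimately show ?thesis unfolding iterated_truncation_face_def prod.case by blast
qed

section \<open>Exchange of the two complementary faces\<close>

lemma combinatorially_equivalent_complementary_truncations:
  fixes P :: "'a::euclidean_space set"
  assumes P: "polytope P" and T: "is_truncation P F Q G"
    and S1: "S1 face_of G" and S2: "S2 face_of G"
    and compl1: "\<forall>D. D face_of G \<longrightarrow> (D \<subseteq> S1 \<longleftrightarrow> D \<inter> S2 = {})"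
    and compl2: "\<forall>D. D face_of G \<longrightarrow> (D \<subseteq> S2 \<longleftrightarrow> D \<inter> S1 = {})"
    and T1: "is_truncation Q S1 R1 N1" and T2: "is_truncation Q S2 R2 N2"
  shows "combinatorially_equivalent R1 R2"
proof (rule combinatorially_equivalentI)
  let ?swap = "\<lambda>(E, s, t). (E, t, s)"
  let ?I1 = "iterated_truncation_index P F G S1 S2" and ?I2 = "iterated_truncation_index P F G S2 S1"
  show "iterated_truncation_face Q G R1 N1 ` ?I1 = {X. X face_of R1 \<and> X \<noteq> {}}"
    by (rule nonempty_faces_of_iterated_truncation[OF P T S1 compl1 T1])
  have swap: "(E, t, s) \<in> ?I2 \<longleftrightarrow> (E, s, t) \<in> ?I1" for E s t
    by (auto simp: iterated_truncation_index_def)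
  then have "?swap ` ?I1 = ?I2"
    by (force simp: image_iff)
  then have "(iterated_truncation_face Q G R2 N2 \<circ> ?swap) ` ?I1 = iterated_truncation_face Q G R2 N2 ` ?I2"
    by (metis image_comp)
  then show "(iterated_truncation_face Q G R2 N2 \<circ> ?swap) ` ?I1 = {X. X face_of R2 \<and> X \<noteq> {}}"
    using nonempty_faces_of_iterated_truncation[OF P T S2 compl2 T2] by simp
  fix i j
  assume ij: "i \<in> ?I1" "j \<in> ?I1"
  obtain E s t E' s' t' where eq: "i = (E, s, t)" "j = (E', s', t')"
    using prod_cases3 by metis
  have "iterated_truncation_face Q G R1 N1 (E, s, t) \<subseteq> iterated_truncation_face Q G R1 N1 (E', s', t') \<longleftrightarrow>
      E \<subseteq> E' \<and> (s' \<longrightarrow> s) \<and> (t' \<longrightarrow> t)"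
    using ij eq by (intro iterated_truncation_face_subset_iff[OF P T S1 compl1 T1]) auto
  moreover have "iterated_truncation_face Q G R2 N2 (E, t, s) \<subseteq> iterated_truncation_face Q G R2 N2 (E', t', s') \<longleftrightarrow>
      E \<subseteq> E' \<and> (t' \<longrightarrow> t) \<and> (s' \<longrightarrow> s)"
    using ij eq swap by (intro iterated_truncation_face_subset_iff[OF P T S2 compl2 T2]) auto
  ultimately show "iterated_truncation_face Q G R1 N1 i \<subseteq> iterated_truncation_face Q G R1 N1 j \<longleftrightarrow>
      (iterated_truncation_face Q G R2 N2 \<circ> ?swap) i \<subseteq> (iterated_truncation_face Q G R2 N2 \<circ> ?swap) j"
    using eq by auto
qed

theorem proposition4p1:
  fixes P Q G :: "'a::euclidean_space set" and p :: 'a and n :: nat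
  assumes "n \<ge> 2"
    and "simple_polytope P" and "aff_dim P = int n"
    and "p extreme_point_of P"
    and "is_truncation P {p} Q G"
  shows "(int n - 1) simplex G \<and>
    (\<forall>(k::nat) S1 S2 R1 G1 R2 G2.
       k \<le> n - 2 \<and>
       S1 face_of G \<and> int k simplex S1 \<and>
       S2 face_of G \<and> (int n - int k - 2) simplex S2 \<and>
       S1 \<inter> S2 = {} \<and>
       is_truncation Q S1 R1 G1 \<and>
       is_truncation Q S2 R2 G2
       \<longrightarrow> combinatorially_equivalent R1 R2)"
proof (intro conjI allI impI)
  have P: "polytope P" using assms(2) by (simp add: simple_polytope_def)
  show G: "(int n - 1) simplex G"
    using simple_polytope_truncation_vertex_simplex[OF assms(2,4,5)] assms(3) by simp
  fix k :: nat and S1 S2 R1 G1 R2 G2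
  assume "k \<le> n - 2 \<and>
       S1 face_of G \<and> int k simplex S1 \<and>
       S2 face_of G \<and> (int n - int k - 2) simplex S2 \<and>
       S1 \<inter> S2 = {} \<and>
       is_truncation Q S1 R1 G1 \<and>
       is_truncation Q S2 R2 G2"
  then have S1: "S1 face_of G" "int k simplex S1"
    and S2: "S2 face_of G" "(int n - int k - 2) simplex S2"
    and disj: "S1 \<inter> S2 = {}" "S2 \<inter> S1 = {}"
    and T: "is_truncation Q S1 R1 G1" "is_truncation Q S2 R2 G2"
    by auto
  show "combinatorially_equivalent R1 R2"
  proof (rule combinatorially_equivalent_complementary_truncations[OF P assms(5) S1(1) S2(1) _ _ T])
    \<comment> \<open>The dimensions are complementary:
      \<open>k + (n - k - 2) + 1 = n - 1\<close>.\<close>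
    show "\<forall>D. D face_of G \<longrightarrow> (D \<subseteq> S1 \<longleftrightarrow> D \<inter> S2 = {})"
      using face_subset_complementary_simplex_faces[OF G S1 S2 _ disj(1)] by simp
    show "\<forall>D. D face_of G \<longrightarrow> (D \<subseteq> S2 \<longleftrightarrow> D \<inter> S1 = {})"
      using face_subset_complementary_simplex_faces[OF G S2 S1 _ disj(2)] by simp
  qed
qed

end
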